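(* Let $\mathcal{A}$ be the $n$-dimensional null-filiform associative algebra over $\mathbb{C}$ with basis $e_1,\dots,e_n$, and let $P_1$ be a (homogeneous) Rota-Baxter operator of weight $0$ with degree $1$ on $\mathcal{A}$, with associated function $\psi$. Then: (a) If $\psi(1)\psi(2)\neq 0$, then $P_1(e_i)=\frac{2\psi(1)}{i+1}e_{i+1}$; (b) If $\psi(1)\ne 0$ and $\psi(2)=0$, then \[P_1(e_i)=\begin{cases}\frac{2\psi(1)}{i+1}e_{i+1}, & i\ \text{odd},\\ 0,&\text{otherwise;}\end{cases}\] (c) If $\psi(1)=0$ and $\psi(t)\ne 0$ for some $2\le t\le\lfloor (n-2)/2\rfloor$, then \[P_1(e_i)=\begin{cases}\frac{(t+1)\psi(t)}{i+1}e_{i+1}, & i+1\equiv 0\ (\bmod\ t+1),\\ 0,&\text{otherwise;}\end{cases}\] (d) If $\psi(t)=0$ for all $1\le t\le\lfloor (n-2)/2\rfloor$, then \[P_1(e_i)=\begin{cases}\psi(r)e_{r+1}, & i=r,\\ \psi(r+1)e_{r+2}, & i=r+1,\\ 0,&\text{otherwise,}\end{cases}\] for some fixed $\lfloor (n-2)/2\rfloor<r\le n-2$.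
   Context: The $n$-dimensional null-filiform associative algebra $\mathcal{A}$ over $\mathbb{C}$ has basis $e_1,\dots,e_n$ and bilinear product $e_ie_j=e_{i+j}$ if $i+j\le n$, and $e_ie_j=0$ otherwise; the symbol $e_m$ with $m>n$ is read as $0$. A homogeneous operator of degree $1$ on $\mathcal{A}$ is a linear map $P_1$ with $P_1(e_i)=\psi(i)e_{i+1}$ for $1\le i\le n-1$ and $P_1(e_n)=\psi(n)e_1$, where $\psi:\mathbb{N}\to\mathbb{C}$ is a function. A Rota-Baxter operator of weight $\lambda$ is a linear map $P:\mathcal{A}\to\mathcal{A}$ with $P(x)P(y)=P(xP(y)+P(x)y+\lambda xy)$ for all $x,y\in\mathcal{A}$.
   Formalization: Part (a) is stated for n ≥ 6, (b) for n ≥ 2 and (d) for n ≥ 3, since each fails for smaller n (in (a), n = 2 is vacuous); in (c), t is taken to be the smallest index with ψ(t) ≠ 0, since the formula fails for any other t. *)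

theory Defs
  imports Complex_Main
begin

locale complex_associative_algebra = vector_space scale
  for scale :: "complex \<Rightarrow> 'a::ab_group_add \<Rightarrow> 'a"  (infixr \<open>\<cdot>\<close> 75) +
  fixes mult :: "'a \<Rightarrow> 'a \<Rightarrow> 'a"  (infixl \<open>\<odot>\<close> 70)
  assumes linear_mult_right: "Vector_Spaces.linear scale scale (\<lambda>y. x \<odot> y)"
    and linear_mult_left: "Vector_Spaces.linear scale scale (\<lambda>x. x \<odot> y)"
    and mult_assoc: "(x \<odot> y) \<odot> z = x \<odot> (y \<odot> z)"

text \<open>
  The basis is \<open>e 1, \<dots>, e n\<close>. The value \<open>e 0\<close> is irrelevant, and \<open>e m = 0\<close> for \<open>m > n\<close>
  is the convention on out-of-range basis symbols, so that \<open>product\<close> also covers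
  \<open>e i \<odot> e j = 0\<close> for \<open>i + j > n\<close>.
\<close>
locale null_filiform_algebra = complex_associative_algebra scale mult
  for scale :: "complex \<Rightarrow> 'a::ab_group_add \<Rightarrow> 'a"  (infixr \<open>\<cdot>\<close> 75)
    and mult :: "'a \<Rightarrow> 'a \<Rightarrow> 'a"  (infixl \<open>\<odot>\<close> 70) +
  fixes n :: nat and e :: "nat \<Rightarrow> 'a"
  assumes inj_basis: "inj_on e {1..n}"
    and independent_basis: "independent (e ` {1..n})"
    and span_basis: "span (e ` {1..n}) = UNIV"
    and out_of_range: "m > n \<Longrightarrow> e m = 0"
    and product: "\<lbrakk>i \<in> {1..n}; j \<in> {1..n}\<rbrakk> \<Longrightarrow> e i \<odot> e j = e (i + j)"

definition homogeneous_degree_1 ::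
  "(complex \<Rightarrow> 'a::ab_group_add \<Rightarrow> 'a) \<Rightarrow> nat \<Rightarrow> (nat \<Rightarrow> 'a) \<Rightarrow> (nat \<Rightarrow> complex) \<Rightarrow> ('a \<Rightarrow> 'a) \<Rightarrow> bool"
  where
  "homogeneous_degree_1 scale n e \<psi> P \<longleftrightarrow>
     Vector_Spaces.linear scale scale P \<and>
     (\<forall>i\<in>{1..<n}. P (e i) = scale (\<psi> i) (e (i + 1))) \<and>
     P (e n) = scale (\<psi> n) (e 1)"

definition rota_baxter_operator ::
  "(complex \<Rightarrow> 'a::ab_group_add \<Rightarrow> 'a) \<Rightarrow> ('a \<Rightarrow> 'a \<Rightarrow> 'a) \<Rightarrow> complex \<Rightarrow> ('a \<Rightarrow> 'a) \<Rightarrow> bool"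
  where
  "rota_baxter_operator scale mult w P \<longleftrightarrow>
     Vector_Spaces.linear scale scale P \<and>
     (\<forall>x y. mult (P x) (P y) = P (mult x (P y) + mult (P x) y + scale w (mult x y)))"

end

theory Submission
  imports Defs
begin

text \<open>
  Evaluating the Rota-Baxter identity at \<open>(e (n-1), e n)\<close> forces \<open>\<psi> n = 0\<close> for \<open>n \<ge> 2\<close>, and
  evaluating it at \<open>(e i, e j)\<close> gives \<open>\<psi> i * \<psi> j = (\<psi> i + \<psi> j) * \<psi> (i + j + 1)\<close> for
  \<open>i + j + 2 \<le> n\<close>.  On nonzero values this says that \<open>1 / \<psi>\<close> is additive for the law
  \<open>(i, j) \<mapsto> i + j + 1\<close>.  Hence if \<open>t\<close> is the first index with \<open>\<psi> t \<noteq> 0\<close>, taking \<open>i = t\<close> determines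
  \<open>\<psi> (j + t + 1)\<close> from \<open>\<psi> j\<close>, so everything is determined by \<open>\<psi>\<close> on \<open>{1..t + 1}\<close>, where only
  \<open>\<psi> (t + 1)\<close> remains to be found.
\<close>

section \<open>From the Rota-Baxter identity to a recurrence for \<open>\<psi>\<close>\<close>

definition rb_recurrence :: "nat \<Rightarrow> (nat \<Rightarrow> complex) \<Rightarrow> bool" where
  "rb_recurrence n \<psi> \<longleftrightarrow>
     (\<forall>i j. 1 \<le> i \<longrightarrow> 1 \<le> j \<longrightarrow> i + j + 2 \<le> n \<longrightarrow> \<psi> i * \<psi> j = (\<psi> i + \<psi> j) * \<psi> (i + j + 1))"

lemma rb_recurrenceD:
  "\<lbrakk>rb_recurrence n \<psi>; 1 \<le> i; 1 \<le> j; i + j + 2 \<le> n\<rbrakk>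
    \<Longrightarrow> \<psi> i * \<psi> j = (\<psi> i + \<psi> j) * \<psi> (i + j + 1)"
  by (simp add: rb_recurrence_def)

lemma (in null_filiform_algebra) basis_nonzero: "i \<in> {1..n} \<Longrightarrow> e i \<noteq> 0"
  using independent_basis dependent_zero by (metis imageI)

lemma (in null_filiform_algebra) product_eq:
  assumes "1 \<le> i" "1 \<le> j" shows "e i \<odot> e j = e (i + j)"
proof -
  have "x \<odot> 0 = 0" "0 \<odot> x = 0" for x
    using module_hom.zero[OF Vector_Spaces.linear.axioms(3)[OF linear_mult_right]]
      module_hom.zero[OF Vector_Spaces.linear.axioms(3)[OF linear_mult_left]] by auto
  then show ?thesis
    using assms product out_of_range by (cases "i \<le> n"; cases "j \<le> n") auto
qed

lemma (in null_filiform_algebra) product_scale: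
  "(a \<cdot> x) \<odot> y = a \<cdot> (x \<odot> y)" "x \<odot> (a \<cdot> y) = a \<cdot> (x \<odot> y)"
  using module_hom.scale[OF Vector_Spaces.linear.axioms(3)[OF linear_mult_left]]
    module_hom.scale[OF Vector_Spaces.linear.axioms(3)[OF linear_mult_right]] by auto

context null_filiform_algebra
begin

context
  fixes \<psi> :: "nat \<Rightarrow> complex" and P :: "'a \<Rightarrow> 'a"
  assumes hom: "homogeneous_degree_1 scale n e \<psi> P"
    and rb: "rota_baxter_operator scale mult 0 P"
begin

lemma linear_operator: "Vector_Spaces.linear scale scale P"
  using rb by (simp add: rota_baxter_operator_def)

lemma operator_scale: "P (a \<cdot> x) = a \<cdot> P x"
  by (rule module_hom.scale[OF Vector_Spaces.linear.axioms(3)[OF linear_operator]])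

lemma operator_add: "P (x + y) = P x + P y"
  by (rule module_hom.add[OF Vector_Spaces.linear.axioms(3)[OF linear_operator]])

lemma operator_zero: "P 0 = 0"
  by (rule module_hom.zero[OF Vector_Spaces.linear.axioms(3)[OF linear_operator]])

lemma rota_baxter: "P x \<odot> P y = P (x \<odot> P y) + P (P x \<odot> y)"
  using rb by (simp add: rota_baxter_operator_def operator_add)

lemma operator_basis: "1 \<le> i \<Longrightarrow> i < n \<Longrightarrow> P (e i) = \<psi> i \<cdot> e (i + 1)"
  using hom by (simp add: homogeneous_degree_1_def)

lemma operator_last: "P (e n) = \<psi> n \<cdot> e 1"
  using hom by (simp add: homogeneous_degree_1_def)

lemma degree_1_last_zero:
  assumes "n \<ge> 2" shows "\<psi> n = 0"
proof -
  have "P (e (n - 1)) = \<psi> (n - 1) \<cdot> e n"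
    using operator_basis[of "n - 1"] assms by simp
  \<comment> \<open>Every product of index above \<open>n\<close> vanishes; only
    \<open>e (n - 1) \<odot> P (e n) = \<psi> n \<cdot> e n\<close> survives, and a second
    application of \<open>P\<close> wraps it to \<open>e 1\<close>.\<close>
  with rota_baxter[of "e (n - 1)" "e n"] have "(\<psi> n * \<psi> n) \<cdot> e 1 = 0"
    using assms by (simp add: operator_last product_scale product_eq out_of_range operator_scale
      operator_zero)
  then show ?thesis using basis_nonzero[of 1] assms by simp
qed

text \<open>The wrap-around at \<open>n\<close> is harmless: \<open>\<psi> n = 0\<close>, so both
  sides are zero there and one formula covers the whole basis.\<close>

lemma operator_basis_le:
  assumes "n \<ge> 2" "i \<in> {1..n}" shows "P (e i) = \<psi> i \<cdot> e (i + 1)"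
proof (cases "i = n")
  case True
  then show ?thesis
    using degree_1_last_zero assms operator_last by simp
qed (use assms operator_basis in auto)

lemma degree_1_recurrence: "rb_recurrence n \<psi>"
  unfolding rb_recurrence_def
proof (intro allI impI)
  fix i j :: nat
  assume ij: "1 \<le> i" "1 \<le> j" "i + j + 2 \<le> n"
  have "P (e i) = \<psi> i \<cdot> e (i + 1)" "P (e j) = \<psi> j \<cdot> e (j + 1)"
    "P (e (i + j + 1)) = \<psi> (i + j + 1) \<cdot> e (i + j + 2)"
    using ij operator_basis[of i] operator_basis[of j] operator_basis[of "i + j + 1"] by auto
  with rota_baxter[of "e i" "e j"] ij
  have "(\<psi> i * \<psi> j) \<cdot> e (i + j + 2) = ((\<psi> i + \<psi> j) * \<psi> (i + j + 1)) \<cdot> e (i + j + 2)"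
    by (simp add: product_scale product_eq operator_scale scale_left_distrib algebra_simps)
  then show "\<psi> i * \<psi> j = (\<psi> i + \<psi> j) * \<psi> (i + j + 1)"
    \<comment> \<open>The bound \<open>i + j + 2 \<le> n\<close> is what allows the coefficients of
      \<open>e (i + j + 2)\<close> to be compared.\<close>
    using basis_nonzero[of "i + j + 2"] ij by simp
qed

end

end

section \<open>Solutions of the recurrence\<close>

text \<open>\<open>D\<close> describes the support of \<open>\<psi>\<close>. On it,
  \<open>1 / \<psi> k = (k + 1) / c\<close> is consistent with additivity, since
  \<open>(t + 1) + (j + 1) = k + 1\<close> for \<open>k = j + t + 1\<close>. Each step shifts the
  index by \<open>t + 1\<close>, hence the periodicity of \<open>D\<close> and a base block of
  length \<open>t + 1\<close>.\<close>

lemma rb_recurrence_propagate: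
  fixes \<psi> :: "nat \<Rightarrow> complex"
  assumes rec: "rb_recurrence n \<psi>" and t: "1 \<le> t" and c: "c \<noteq> 0" "\<psi> t = c / of_nat (t + 1)"
    and periodic: "\<And>k. D (k + (t + 1)) \<longleftrightarrow> D k"
    and base: "\<And>k. 1 \<le> k \<Longrightarrow> k \<le> t + 1 \<Longrightarrow> k < n \<Longrightarrow> \<psi> k = (if D k then c / of_nat (k + 1) else 0)"
    and k: "1 \<le> k" "k < n"
  shows "\<psi> k = (if D k then c / of_nat (k + 1) else 0)"
  using k
proof (induction k rule: less_induct)
  case (less k)
  show ?case
  proof (cases "k \<le> t + 1")
    case False
    define j where "j = k - (t + 1)"
    have j: "1 \<le> j" "j < k" "k = j + (t + 1)"
      using False by (auto simp: j_def)
    have IH: "\<psi> j = (if D j then c / of_nat (j + 1) else 0)"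
      using less.IH[of j] j less.prems by simp
    have eq: "\<psi> t * \<psi> j = (\<psi> t + \<psi> j) * \<psi> k"
      using rb_recurrenceD[OF rec, of t j] j t less.prems by (simp add: ac_simps)
    have nz: "of_nat (j + 1) \<noteq> (0 :: complex)" "of_nat (t + 1) \<noteq> (0 :: complex)"
      "of_nat (k + 1) \<noteq> (0 :: complex)"
      by (simp_all only: of_nat_eq_0_iff)
    have k1: "of_nat (k + 1) = (of_nat (j + 1) + of_nat (t + 1) :: complex)"
      using j by simp
    show ?thesis
    proof (cases "D k")
      case True
      then have pj: "\<psi> j = c / of_nat (j + 1)"
        using IH j periodic by simp
      define a b :: complex where "a = of_nat (j + 1)" and "b = of_nat (t + 1)"
      have "(c / b) * (c / a) = (c / b + c / a) * \<psi> k"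
        using eq pj c(2) by (simp only: a_def b_def)
      moreover have "a \<noteq> 0" "b \<noteq> 0" "a + b \<noteq> 0"
        using nz k1 by (simp_all only: a_def b_def not_False_eq_True)
      ultimately have "c * c = c * ((a + b) * \<psi> k)"
        by (simp add: field_simps)
      then have "\<psi> k = c / (a + b)"
        using c(1) \<open>a + b \<noteq> 0\<close> by (simp add: eq_divide_eq mult.commute)
      then show ?thesis
        using True by (simp only: k1 a_def b_def if_True)
    next
      case False
      \<comment> \<open>Here \<open>\<psi> j = 0\<close>, and the recurrence collapses to
        \<open>\<psi> t * \<psi> k = 0\<close>.\<close>
      then show ?thesis
        using IH eq j periodic nz c by simp
    qed
  qed (use base less.prems in auto)
qed

text \<open>The index 5 is reached both as \<open>1 + 3 + 1\<close> and as \<open>2 + 2 + 1\<close>;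
  comparing the two fixes \<open>\<psi> 2\<close>, after which propagation with \<open>t = 1\<close>
  applies. Both instances require \<open>n \<ge> 6\<close>.\<close>

lemma rb_recurrence_full_support:
  assumes rec: "rb_recurrence n \<psi>" and "n \<ge> 6" "\<psi> 1 * \<psi> 2 \<noteq> 0" "1 \<le> k" "k < n"
  shows "\<psi> k = 2 * \<psi> 1 / of_nat (k + 1)"
proof -
  have "\<psi> 1 * \<psi> 1 = (\<psi> 1 + \<psi> 1) * \<psi> 3" "\<psi> 1 * \<psi> 3 = (\<psi> 1 + \<psi> 3) * \<psi> 5"
    "\<psi> 2 * \<psi> 2 = (\<psi> 2 + \<psi> 2) * \<psi> 5"
    using rb_recurrenceD[OF rec, of 1 1] rb_recurrenceD[OF rec, of 1 3]
      rb_recurrenceD[OF rec, of 2 2] assms(2) by (simp_all add: numeral_eq_Suc)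
  moreover from this have "\<psi> 3 = \<psi> 1 / 2" "\<psi> 5 = \<psi> 2 / 2"
    using assms(3) by (auto simp: field_simps)
  ultimately have "\<psi> 1 * (\<psi> 1 / 2) = (\<psi> 1 + \<psi> 1 / 2) * (\<psi> 2 / 2)"
    by simp
  then have "\<psi> 1 * (2 * \<psi> 1 - 3 * \<psi> 2) = 0"
    by (simp add: algebra_simps)
  then have psi2: "\<psi> 2 = 2 * \<psi> 1 / 3"
    using assms(3) by (simp add: field_simps)
  \<comment> \<open>The trivial conditional gives the goal the shape of the propagation lemma with
    \<open>D\<close> constantly true.\<close>
  have "\<psi> k = (if True then 2 * \<psi> 1 / of_nat (k + 1) else 0)"
  proof (rule rb_recurrence_propagate[OF rec, of 1 _ "\<lambda>_. True"])
    fix i :: nat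
    assume "1 \<le> i" "i \<le> 1 + 1"
    then have "i = 1 \<or> i = 2" by auto
    then show "\<psi> i = (if True then 2 * \<psi> 1 / of_nat (i + 1) else 0)"
      using psi2 by auto
  qed (use assms in auto)
  then show ?thesis by simp
qed

text \<open>Propagation with \<open>t = 1\<close>, thus period 2; the base block is given by the
  hypotheses, so nothing needs to be derived about \<open>\<psi> 2\<close>.\<close>

lemma rb_recurrence_odd_support:
  assumes rec: "rb_recurrence n \<psi>" and "\<psi> 1 \<noteq> 0" "\<psi> 2 = 0" "1 \<le> k" "k < n"
  shows "\<psi> k = (if odd k then 2 * \<psi> 1 / of_nat (k + 1) else 0)"
proof (rule rb_recurrence_propagate[OF rec, of 1])
  fix i :: nat
  assume "1 \<le> i" "i \<le> 1 + 1"
  then have "i = 1 \<or> i = 2" by auto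
  then show "\<psi> i = (if odd i then 2 * \<psi> 1 / of_nat (i + 1) else 0)"
    using assms(3) by auto
qed (use assms in auto)

text \<open>The unknown base value \<open>\<psi> (t + 1)\<close> is forced to vanish by reaching
  \<open>2 * t + 1\<close> in two ways: the pair \<open>(t, t)\<close> shows
  \<open>\<psi> (2 * t + 1) \<noteq> 0\<close>, while \<open>(t + 1, t - 1)\<close>, with
  \<open>\<psi> (t - 1) = 0\<close>, gives
  \<open>\<psi> (t + 1) * \<psi> (2 * t + 1) = 0\<close>.\<close>

lemma rb_recurrence_periodic_support:
  assumes rec: "rb_recurrence n \<psi>" and t: "2 \<le> t" "2 * t + 2 \<le> n" "\<psi> t \<noteq> 0"
    and first: "\<forall>s\<in>{1..<t}. \<psi> s = 0" and k: "1 \<le> k" "k < n"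
  shows "\<psi> k = (if (k + 1) mod (t + 1) = 0 then of_nat (t + 1) * \<psi> t / of_nat (k + 1) else 0)"
proof (rule rb_recurrence_propagate[OF rec, of t])
  have "\<psi> t * \<psi> t = (\<psi> t + \<psi> t) * \<psi> (2 * t + 1)"
    using rb_recurrenceD[OF rec, of t t] t by (simp add: mult_2[of t])
  then have "\<psi> (2 * t + 1) \<noteq> 0" using t(3) by auto
  moreover have "\<psi> (t + 1) * \<psi> (t - 1) = (\<psi> (t + 1) + \<psi> (t - 1)) * \<psi> (2 * t + 1)"
    using rb_recurrenceD[OF rec, of "t + 1" "t - 1"] t by (simp add: mult_2[of t])
  moreover have "\<psi> (t - 1) = 0" using first t by simp
  ultimately have t1: "\<psi> (t + 1) = 0" by simp
  fix i :: nat
  assume i: "1 \<le> i" "i \<le> t + 1"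
  then consider "i < t" | "i = t" | "i = t + 1" by linarith
  then show "\<psi> i = (if (i + 1) mod (t + 1) = 0 then of_nat (t + 1) * \<psi> t / of_nat (i + 1) else 0)"
  proof cases
    case 1
    then show ?thesis using first i by simp
  next
    case 2
    then show ?thesis by (simp del: of_nat_Suc of_nat_add)
  next
    case 3
    then show ?thesis using t1 t(1) by (simp add: mod_Suc)
  qed
next
  fix i
  have "i + (t + 1) + 1 = (i + 1) + (t + 1)" by simp
  then show "((i + (t + 1) + 1) mod (t + 1) = 0) \<longleftrightarrow> ((i + 1) mod (t + 1) = 0)"
    by (simp only: mod_add_self2)
next
  show "of_nat (t + 1) * \<psi> t \<noteq> 0" using t(3) by (simp del: of_nat_Suc of_nat_add)
  show "\<psi> t = of_nat (t + 1) * \<psi> t / of_nat (t + 1)" by (simp del: of_nat_Suc of_nat_add)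
qed (use t k in auto)

text \<open>Take \<open>r\<close> to be the first index up to \<open>n - 2\<close> with
  \<open>\<psi> r \<noteq> 0\<close>. An index beyond \<open>r + 1\<close> is
  \<open>r + j + 1\<close> with \<open>j\<close> in the range where \<open>\<psi>\<close> vanishes,
  so the recurrence at \<open>(r, j)\<close> kills its value.\<close>

lemma rb_recurrence_late_support:
  assumes rec: "rb_recurrence n \<psi>" and n: "n \<ge> 3"
    and zero: "\<forall>t\<in>{1..(n - 2) div 2}. \<psi> t = 0"
  shows "\<exists>r. (n - 2) div 2 < r \<and> r \<le> n - 2 \<and>
    (\<forall>i\<in>{1..<n}. i \<noteq> r \<longrightarrow> i \<noteq> r + 1 \<longrightarrow> \<psi> i = 0)"
proof (cases "\<exists>r. 1 \<le> r \<and> r \<le> n - 2 \<and> \<psi> r \<noteq> 0")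
  case False
  have "\<psi> i = 0" if "i \<in> {1..<n}" "i \<noteq> n - 1" for i
  proof -
    have "1 \<le> i \<and> i \<le> n - 2" using that by auto
    then show ?thesis using False by blast
  qed
  \<comment> \<open>Only \<open>\<psi> (n - 1)\<close> may be nonzero, and \<open>r = n - 2\<close>
    captures it as \<open>r + 1\<close>; \<open>n \<ge> 3\<close> ensures
    \<open>(n - 2) div 2 < n - 2\<close>.\<close>
  then show ?thesis
    using n by (intro exI[of _ "n - 2"]) auto
next
  case True
  define r where "r = (LEAST r. 1 \<le> r \<and> r \<le> n - 2 \<and> \<psi> r \<noteq> 0)"
  have r: "1 \<le> r" "r \<le> n - 2" "\<psi> r \<noteq> 0"
    using LeastI_ex[OF True] unfolding r_def by auto
  have below: "\<psi> i = 0" if "1 \<le> i" "i < r" for i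
    using not_less_Least[of i "\<lambda>r. 1 \<le> r \<and> r \<le> n - 2 \<and> \<psi> r \<noteq> 0"] that r(2)
    unfolding r_def[symmetric] by auto
  have late: "(n - 2) div 2 < r"
    using zero r by (meson atLeastAtMost_iff not_le)
  have "\<psi> i = 0" if "i \<in> {1..<n}" "i \<noteq> r" "i \<noteq> r + 1" for i
  proof (cases "i < r")
    case False
    define j where "j = i - (r + 1)"
    \<comment> \<open>From \<open>i \<le> n - 1\<close>, \<open>j \<le> (n - 2) - r\<close>, which
      is at most \<open>(n - 2) div 2\<close> because \<open>r\<close> exceeds that half.\<close>
    have j: "1 \<le> j" "i = r + j + 1" "j \<le> (n - 2) div 2"
      using False that late by (auto simp: j_def)
    have "\<psi> j = 0" using j zero by simp
    then show ?thesis
      using rb_recurrenceD[OF rec r(1) j(1)] that j r(3) by simp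
  qed (use below that in auto)
  then show ?thesis using r late by auto
qed

text \<open>The bounds on \<open>n\<close> exclude degenerate cases: for \<open>n = 5\<close> the
  recurrence yields only \<open>\<psi> 3\<close> and \<open>\<psi> 4\<close>, leaving
  \<open>\<psi> 2\<close> free apart from \<open>\<psi> 1 + \<psi> 2 \<noteq> 0\<close>; for
  \<open>n = 1\<close>, \<open>P (e 1) = \<psi> 1 \<cdot> e 1\<close> while \<open>e 2 = 0\<close>;
  for \<open>n = 2\<close> no \<open>r\<close> fits the range in (d). In (c), \<open>t\<close> is
  the first nonzero index: the formula for a later one would send \<open>e\<close> at the first to
  zero.\<close>

theorem theorem3p7:
  fixes scale :: "complex \<Rightarrow> 'a::ab_group_add \<Rightarrow> 'a"
    and mult :: "'a \<Rightarrow> 'a \<Rightarrow> 'a"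
    and n :: nat
    and e :: "nat \<Rightarrow> 'a"
    and \<psi> :: "nat \<Rightarrow> complex"
    and P :: "'a \<Rightarrow> 'a"
  assumes "null_filiform_algebra scale mult n e"
    and "homogeneous_degree_1 scale n e \<psi> P"
    and "rota_baxter_operator scale mult 0 P"
  shows
    "(n \<ge> 6 \<longrightarrow> \<psi> 1 * \<psi> 2 \<noteq> 0 \<longrightarrow>
        (\<forall>i\<in>{1..n}. P (e i) = scale (2 * \<psi> 1 / of_nat (i + 1)) (e (i + 1))))
   \<and> (n \<ge> 2 \<longrightarrow> \<psi> 1 \<noteq> 0 \<and> \<psi> 2 = 0 \<longrightarrow>
        (\<forall>i\<in>{1..n}. P (e i) =
           (if odd i then scale (2 * \<psi> 1 / of_nat (i + 1)) (e (i + 1)) else 0)))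
   \<and> (\<psi> 1 = 0 \<and> (\<exists>t\<in>{2..(n - 2) div 2}. \<psi> t \<noteq> 0) \<longrightarrow>
        (\<exists>t\<in>{2..(n - 2) div 2}. \<psi> t \<noteq> 0 \<and> (\<forall>s\<in>{1..<t}. \<psi> s = 0) \<and>
          (\<forall>i\<in>{1..n}. P (e i) =
             (if (i + 1) mod (t + 1) = 0
              then scale (of_nat (t + 1) * \<psi> t / of_nat (i + 1)) (e (i + 1)) else 0))))
   \<and> (n \<ge> 3 \<longrightarrow> (\<forall>t\<in>{1..(n - 2) div 2}. \<psi> t = 0) \<longrightarrow>
        (\<exists>r. (n - 2) div 2 < r \<and> r \<le> n - 2 \<and>
          (\<forall>i\<in>{1..n}. P (e i) =
             (if i = r then scale (\<psi> r) (e (r + 1))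
              else if i = r + 1 then scale (\<psi> (r + 1)) (e (r + 2))
              else 0))))"
proof -
  interpret null_filiform_algebra scale mult n e by (fact assms(1))
  note rec = degree_1_recurrence[OF assms(2,3)]
  note P = operator_basis_le[OF assms(2,3)]
  \<comment> \<open>At \<open>i = n\<close> both sides vanish because \<open>e (n + 1) = 0\<close>,
    so \<open>a\<close> has to agree with \<open>\<psi> i\<close> only below
    \<open>n\<close>.\<close>
  have P_cong: "P (e i) = scale a (e (i + 1))" if "n \<ge> 2" "i \<in> {1..n}" "i < n \<Longrightarrow> \<psi> i = a" for i a
    using that P[of i] out_of_range[of "i + 1"] by (cases "i = n") auto
  have P_zero: "P (e i) = 0" if "n \<ge> 2" "i \<in> {1..n}" "i < n \<Longrightarrow> \<psi> i = 0" for i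
    using P_cong[OF that] by simp
  have a: "P (e i) = scale (2 * \<psi> 1 / of_nat (i + 1)) (e (i + 1))"
    if "n \<ge> 6" "\<psi> 1 * \<psi> 2 \<noteq> 0" "i \<in> {1..n}" for i
    using that rb_recurrence_full_support[OF rec, of i] by (intro P_cong) auto
  have b: "P (e i) = (if odd i then scale (2 * \<psi> 1 / of_nat (i + 1)) (e (i + 1)) else 0)"
    if "n \<ge> 2" "\<psi> 1 \<noteq> 0" "\<psi> 2 = 0" "i \<in> {1..n}" for i
    using that rb_recurrence_odd_support[OF rec, of i]
    by (cases "odd i") (simp_all del: of_nat_Suc of_nat_add add: P_cong P_zero)
  have c: "\<exists>t\<in>{2..(n - 2) div 2}. \<psi> t \<noteq> 0 \<and> (\<forall>s\<in>{1..<t}. \<psi> s = 0) \<and>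
          (\<forall>i\<in>{1..n}. P (e i) =
             (if (i + 1) mod (t + 1) = 0
              then scale (of_nat (t + 1) * \<psi> t / of_nat (i + 1)) (e (i + 1)) else 0))"
    if psi1: "\<psi> 1 = 0" and ex: "\<exists>t\<in>{2..(n - 2) div 2}. \<psi> t \<noteq> 0"
  proof -
    \<comment> \<open>The conjunct \<open>1 \<le> t\<close> keeps the arbitrary value
      \<open>\<psi> 0\<close> out of the search for a least index.\<close>
    define Q where "Q t \<longleftrightarrow> 1 \<le> t \<and> \<psi> t \<noteq> 0" for t
    obtain u where u: "u \<in> {2..(n - 2) div 2}" "Q u" using ex by (auto simp: Q_def)
    then obtain t where Qt: "Q t" and least: "\<And>s. s < t \<Longrightarrow> \<not> Q s"
      using exists_least_iff[of Q] by blast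
    have tu: "t \<le> u" using least u(2) by (meson not_le)
    have first: "\<forall>s\<in>{1..<t}. \<psi> s = 0" using least by (simp add: Q_def)
    have "t \<noteq> 1" using Qt psi1 by (auto simp: Q_def)
    then have t: "2 \<le> t" "2 * t + 2 \<le> n" "\<psi> t \<noteq> 0" "t \<in> {2..(n - 2) div 2}"
      using Qt tu u(1) by (auto simp: Q_def)
    have "P (e i) = (if (i + 1) mod (t + 1) = 0
              then scale (of_nat (t + 1) * \<psi> t / of_nat (i + 1)) (e (i + 1)) else 0)"
      if "i \<in> {1..n}" for i
    proof (cases "(i + 1) mod (t + 1) = 0")
      case True
      have "P (e i) = scale (of_nat (t + 1) * \<psi> t / of_nat (i + 1)) (e (i + 1))"
        using that True t rb_recurrence_periodic_support[OF rec t(1-3) first, of i]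
        by (intro P_cong) auto
      then show ?thesis using True by simp
    next
      case False
      have "P (e i) = 0"
        using that False t rb_recurrence_periodic_support[OF rec t(1-3) first, of i]
        by (intro P_zero) auto
      then show ?thesis using False by simp
    qed
    then show ?thesis using t first by blast
  qed
  have d: "\<exists>r. (n - 2) div 2 < r \<and> r \<le> n - 2 \<and>
          (\<forall>i\<in>{1..n}. P (e i) =
             (if i = r then scale (\<psi> r) (e (r + 1))
              else if i = r + 1 then scale (\<psi> (r + 1)) (e (r + 2))
              else 0))"
    if n: "n \<ge> 3" and zero: "\<forall>t\<in>{1..(n - 2) div 2}. \<psi> t = 0"
  proof -
    obtain r where r: "(n - 2) div 2 < r" "r \<le> n - 2"
      and supp: "\<forall>i\<in>{1..<n}. i \<noteq> r \<longrightarrow> i \<noteq> r + 1 \<longrightarrow> \<psi> i = 0"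
      using rb_recurrence_late_support[OF rec n zero] by blast
    have "P (e i) = (if i = r then scale (\<psi> r) (e (r + 1))
              else if i = r + 1 then scale (\<psi> (r + 1)) (e (r + 2)) else 0)"
      if "i \<in> {1..n}" for i
      using P[of i] P_zero[of i] supp that n by auto
    then show ?thesis using r by blast
  qed
  show ?thesis
    using a b c d by blast
qed

end
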